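(* If $R$ is a finite ring and $\mathbb{F}$ is a finite field whose characteristic divides $|R|$, then for any network $\mathcal{N}$ the linear capacity of $\mathcal{N}$ over $R$ is less than or equal to its linear capacity over $\mathbb{F}$, i.e., $\mathcal{C}_{lin}(\mathcal{N},R)\le\mathcal{C}_{lin}(\mathcal{N},\mathbb{F})$.
   Context: Rings are associative with identity $1$, not necessarily commutative. A network is a finite directed acyclic multigraph, some of whose nodes are sources or receivers, with finitely many message vectors (say $m$ of them), each originating at a source node; each receiver demands a specified set of the message vectors. The inputs of a node are the message vectors originating at the node together with the vectors carried by its incoming edges. For integers $k_1,\dots,k_m\ge 0$ and $n\ge 1$, a $(k_1,\dots,k_m,n)$ code over a finite alphabet $\mathcal{A}$ (with $|\mathcal{A}|\ge 2$) lets the $i$th message vector range over $\mathcal{A}^{k_i}$, assigns to each edge an edge function mapping the inputs of the edge's tail node to a vector in $\mathcal{A}^n$ (the vector carried by the edge), and assigns to each receiver and each message vector it demands a decoding function of the receiver's inputs. The code is a solution if, for all values of the message vectors, each decoding function outputs the demanded message vector. Its rate vector is $(k_1/n,\dots,k_m/n)$. For a finite ring $R$, a code over the alphabet $R$ is two-sided linear if every component of every edge function and decoding function, as a function of the components $x_1,\dots,x_s\in R$ of the node's input vectors, has the form $\sum_{i=1}^{s}\sum_{j=1}^{n_i} a_{i,j}\,x_i\,b_{i,j}$ with $a_{i,j},b_{i,j}\in R$. (Equivalently, it is linear over $R$ viewed as a left module over $R\otimes_{\mathbb{Z}}R^{op}$ with $\left(\sum_i a_i\otimes b_i\right)\cdot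 x=\sum_i a_i x b_i$; for commutative $R$, in particular for a field, this is the same as ordinary linearity $\mathbf{x}\mapsto A\mathbf{x}$ with $A$ a matrix over $R$.) A rate vector $\mathbf{r}$ is linearly achievable for $\mathcal{N}$ over $R$ if $\mathcal{N}$ has a two-sided linear solution over $R$ (for some block sizes) with rate vector $\mathbf{r}$, and $\mathcal{C}_{lin}(\mathcal{N},R)=\sup\{r\in\mathbb{Q} : (r,\dots,r)\text{ is linearly achievable for }\mathcal{N}\text{ over }R\}$ (a supremum in the extended reals). *)

theory Defs
  imports
    "Graph_Theory.Digraph"
    "HOL-Library.Cardinality"
    "HOL-Library.FuncSet"
    "HOL-Library.Extended_Real"
    "HOL-Computational_Algebra.Computational_Algebra"
begin

section \<open>Networks\<close>

text \<open>
  The messages are indexed by the natural numbers below \<open>num_messages\<close>; the \<open>i\<close>-th message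
  originates at the node \<open>origin i\<close>. The values of \<open>origin\<close> and \<open>demands\<close> outside of the
  message indices and the receivers are irrelevant.
\<close>
record ('v, 'e) network =
  graph :: "('v, 'e) pre_digraph"
  sources :: "'v set"
  receivers :: "'v set"
  num_messages :: nat
  origin :: "nat \<Rightarrow> 'v"
  demands :: "'v \<Rightarrow> nat set"

text \<open>Parallel arcs are allowed in a \<open>fin_digraph\<close>; loops are excluded by acyclicity.\<close>
locale network = fin_digraph "graph N" for N :: "('v, 'e) network" +
  assumes acyclic: "acyclic (arcs_ends (graph N))"
    and sources_in_verts: "sources N \<subseteq> verts (graph N)"
    and receivers_in_verts: "receivers N \<subseteq> verts (graph N)"
    and origin_in_sources: "i < num_messages N \<Longrightarrow> origin N i \<in> sources N"
    and demands_messages: "v \<in> receivers N \<Longrightarrow> demands N v \<subseteq> {..<num_messages N}"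

datatype 'e input = Message nat | Edge 'e

definition inputs :: "('v, 'e) network \<Rightarrow> 'v \<Rightarrow> 'e input set" where
  "inputs N v = Message ` {i. i < num_messages N \<and> origin N i = v} \<union> Edge ` in_arcs (graph N) v"


section \<open>Codes and solutions\<close>

text \<open>
  The alphabet is the whole type \<open>'a\<close>, and the vectors of length \<open>n\<close> over it are the
  extensional functions on \<open>{..<n}\<close>.
\<close>
definition vectors :: "nat \<Rightarrow> (nat \<Rightarrow> 'a) set" where
  "vectors n = ({..<n} \<rightarrow>\<^sub>E UNIV)"

text \<open>
  A code with the parameters \<open>(message_dim 0, \<dots>, message_dim (m - 1), edge_dim)\<close>, where \<open>m\<close> is
  the number of messages.
\<close>
record ('v, 'e, 'a) code =
  message_dim :: "nat \<Rightarrow> nat"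
  edge_dim :: nat
  edge_fun :: "'e \<Rightarrow> ('e input \<Rightarrow> nat \<Rightarrow> 'a) \<Rightarrow> nat \<Rightarrow> 'a"
  decoding_fun :: "'v \<Rightarrow> nat \<Rightarrow> ('e input \<Rightarrow> nat \<Rightarrow> 'a) \<Rightarrow> nat \<Rightarrow> 'a"

fun input_dim :: "('v, 'e, 'a) code \<Rightarrow> 'e input \<Rightarrow> nat" where
  "input_dim C (Message i) = message_dim C i"
| "input_dim C (Edge e) = edge_dim C"

definition input_space :: "('v, 'e) network \<Rightarrow> ('v, 'e, 'a) code \<Rightarrow> 'v \<Rightarrow> ('e input \<Rightarrow> nat \<Rightarrow> 'a) set" where
  "input_space N C v = (\<Pi>\<^sub>E q\<in>inputs N v. vectors (input_dim C q))"

definition is_code :: "('v, 'e) network \<Rightarrow> ('v, 'e, 'a) code \<Rightarrow> bool" where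
  "is_code N C \<longleftrightarrow>
     edge_dim C \<ge> 1 \<and>
     (\<forall>e\<in>arcs (graph N).
        edge_fun C e \<in> input_space N C (tail (graph N) e) \<rightarrow> vectors (edge_dim C)) \<and>
     (\<forall>v\<in>receivers N. \<forall>i\<in>demands N v.
        decoding_fun C v i \<in> input_space N C v \<rightarrow> vectors (message_dim C i))"

text \<open>
  The inputs of the node \<open>v\<close> when the messages have the values \<open>x\<close> and the edges carry the
  vectors \<open>y\<close>.
\<close>
definition input_values ::
    "('v, 'e) network \<Rightarrow> (nat \<Rightarrow> nat \<Rightarrow> 'a) \<Rightarrow> ('e \<Rightarrow> nat \<Rightarrow> 'a) \<Rightarrow> 'v \<Rightarrow> 'e input \<Rightarrow> nat \<Rightarrow> 'a" where
  "input_values N x y v = restrict (case_input x y) (inputs N v)"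

definition carried ::
    "('v, 'e) network \<Rightarrow> ('v, 'e, 'a) code \<Rightarrow> (nat \<Rightarrow> nat \<Rightarrow> 'a) \<Rightarrow> ('e \<Rightarrow> nat \<Rightarrow> 'a) \<Rightarrow> bool" where
  "carried N C x y \<longleftrightarrow>
     (\<forall>e\<in>arcs (graph N). y e = edge_fun C e (input_values N x y (tail (graph N) e)))"

text \<open>
  By acyclicity, the vectors carried by the edges exist and are determined by the messages, so
  the quantification over \<open>y\<close> in \<open>is_solution\<close> below is neither vacuous nor a choice.
\<close>
lemma (in network) carried_ex1: "\<exists>!y \<in> extensional (arcs (graph N)). carried N C x y"
proof -
  let ?G = "graph N"
  define R where "R = inv_image ((arcs_ends ?G)\<^sup>+) (tail ?G)"
  have "finite (arcs_ends ?G)"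
    by (simp add: arcs_ends_def)
  then have wf: "wf R"
    unfolding R_def using acyclic by (intro wf_inv_image wf_trancl finite_acyclic_wf)
  have less: "(d, e) \<in> R" if "d \<in> in_arcs ?G (tail ?G e)" for d e
    using that by (force simp: R_def in_arcs_def arcs_ends_conv intro: r_into_trancl)
  have cong: "input_values N x y (tail ?G e) = input_values N x y' (tail ?G e)"
    if "\<And>d. d \<in> in_arcs ?G (tail ?G e) \<Longrightarrow> y d = y' d" for y y' e
    using that by (auto simp: input_values_def inputs_def fun_eq_iff restrict_def)
  define F where "F = (\<lambda>y e. if e \<in> arcs ?G then edge_fun C e (input_values N x y (tail ?G e)) else undefined)"
  define y where "y = wfrec R F"
  have y: "y e = F y e" for e
  proof -
    have "y e = F (cut y R e) e"
      unfolding y_def by (rule wfrec[OF wf])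
    also have "\<dots> = F y e"
      using cong[of e "cut y R e" y] less by (auto simp: F_def cut_apply)
    finally show ?thesis .
  qed
  show ?thesis
  proof (rule ex1I[of _ y])
    show "y \<in> extensional (arcs ?G) \<and> carried N C x y"
      using y by (auto simp: carried_def F_def extensional_def)
  next
    fix z assume z: "z \<in> extensional (arcs ?G) \<and> carried N C x z"
    have "z e = y e" for e
    proof (induction e rule: wf_induct_rule[OF wf])
      case (1 e)
      have "z e = F z e"
        using z by (auto simp: carried_def F_def extensional_def)
      also have "\<dots> = F y e"
        using cong[of e z y] less 1 by (auto simp: F_def)
      finally show ?case
        using y by simp
    qed
    then show "z = y" by blast
  qed
qed

definition is_solution :: "('v, 'e) network \<Rightarrow> ('v, 'e, 'a) code \<Rightarrow> bool" where
  "is_solution N C \<longleftrightarrow>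
     is_code N C \<and>
     (\<forall>x \<in> (\<Pi>\<^sub>E i\<in>{..<num_messages N}. vectors (message_dim C i)). \<forall>y. carried N C x y \<longrightarrow>
        (\<forall>v\<in>receivers N. \<forall>i\<in>demands N v. decoding_fun C v i (input_values N x y v) = x i))"


section \<open>Linear codes and linear capacity\<close>

text \<open>
  \<open>g\<close> is a scalar-valued function of the components \<open>u q l\<close> of the inputs of the node \<open>v\<close>.
\<close>
definition two_sided_linear ::
    "('v, 'e) network \<Rightarrow> ('v, 'e, 'a :: ring_1) code \<Rightarrow> 'v \<Rightarrow> (('e input \<Rightarrow> nat \<Rightarrow> 'a) \<Rightarrow> 'a) \<Rightarrow> bool" where
  "two_sided_linear N C v g \<longleftrightarrow>
     (\<exists>(s :: 'e input \<Rightarrow> nat \<Rightarrow> nat) a b. \<forall>u\<in>input_space N C v.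
        g u = (\<Sum>q\<in>inputs N v. \<Sum>l<input_dim C q. \<Sum>j<s q l. a q l j * u q l * b q l j))"

definition is_linear_code :: "('v, 'e) network \<Rightarrow> ('v, 'e, 'a :: ring_1) code \<Rightarrow> bool" where
  "is_linear_code N C \<longleftrightarrow>
     is_code N C \<and>
     (\<forall>e\<in>arcs (graph N). \<forall>l<edge_dim C.
        two_sided_linear N C (tail (graph N) e) (\<lambda>u. edge_fun C e u l)) \<and>
     (\<forall>v\<in>receivers N. \<forall>i\<in>demands N v. \<forall>l<message_dim C i.
        two_sided_linear N C v (\<lambda>u. decoding_fun C v i u l))"

text \<open>
  The ring is the type \<open>'a\<close>, passed as \<open>TYPE('a)\<close>. Only the first \<open>num_messages N\<close> entries
  of \<open>r\<close> matter.
\<close>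
definition linearly_achievable ::
    "('v, 'e) network \<Rightarrow> 'a :: {ring_1, finite} itself \<Rightarrow> (nat \<Rightarrow> real) \<Rightarrow> bool" where
  "linearly_achievable N R r \<longleftrightarrow>
     (\<exists>C :: ('v, 'e, 'a) code. is_linear_code N C \<and> is_solution N C \<and>
        (\<forall>i<num_messages N. r i = real (message_dim C i) / real (edge_dim C)))"

definition linear_capacity :: "('v, 'e) network \<Rightarrow> 'a :: {ring_1, finite} itself \<Rightarrow> ereal" where
  "linear_capacity N R = (SUP r\<in>{r \<in> \<rat>. linearly_achievable N R (\<lambda>_. r)}. ereal r)"

end

theory Submission
  imports Defs "HOL-Algebra.Sylow" "HOL-Algebra.Multiplicative_Group"
begin

text \<open>
  No structure theory of \<open>R\<close> is needed: a solution over \<open>R\<close> yields one over \<open>F\<close> with the same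
  rate vector. The additive maps \<open>h :: F \<Rightarrow> R\<close> form a finite-dimensional vector space over \<open>F\<close>
  under \<open>(c h) x = h (c x)\<close>, and it is nonzero because the characteristic of \<open>F\<close> divides the
  order of \<open>R\<close>. Fix a basis \<open>(h\<^sub>\<beta>)\<close>, \<open>\<beta> < d\<close>. An additive map \<open>\<phi>\<close> of \<open>R\<close>, such as a two-sided
  linear one, acts on this space by composition, \<open>\<phi> (h\<^sub>\<beta> x) = (\<Sum>\<alpha><d. h\<^sub>\<alpha> (M\<^sub>\<alpha>\<^sub>\<beta> x))\<close>, so for every
  \<open>f \<in> F\<close> the map \<open>T\<^sub>f :: F^d \<Rightarrow> R\<close>, \<open>T\<^sub>f c = (\<Sum>\<beta><d. h\<^sub>\<beta> (f c\<^sub>\<beta>))\<close>, intertwines \<open>M\<close> and \<open>\<phi>\<close>.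
  Replacing the alphabet \<open>R\<close> by \<open>F^d\<close> and each \<open>\<phi>\<close> by \<open>M\<close> gives a linear code over \<open>F\<close>. The
  maps \<open>T\<^sub>f\<close> send its runs to runs of the given code and are jointly injective by independence of
  the basis, so the new code decodes correctly.
\<close>

section \<open>Additive maps from a finite field to a finite ring\<close>

text \<open>Sylow's theorem with exponent 1 (Cauchy's theorem) in the additive group of the ring: a
  subgroup of order \<open>p\<close> has a nonzero element, and \<open>p\<close> annihilates
  it.\<close>

lemma exists_torsion_element:
  assumes "prime p" "p dvd CARD('r :: {ring_1, finite})"
  shows "\<exists>r :: 'r. r \<noteq> 0 \<and> of_nat p * r = 0"
proof -
  define G where "G = \<lparr>carrier = (UNIV :: 'r set), mult = (+), one = (0 :: 'r)\<rparr>"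
  have G: "group G"
    by (rule groupI) (auto simp: G_def algebra_simps intro: exI[of _ "- x" for x])
  obtain m where "CARD('r) = p ^ 1 * m"
    using assms(2) by auto
  then have "order G = p ^ 1 * m"
    by (simp add: order_def G_def)
  with sylow_thm[OF assms(1) G, of 1 m] obtain H where H: "subgroup H G" "card H = p"
    by (auto simp: G_def)
  have "H \<noteq> {0}"
    using H(2) assms(1) by auto
  moreover have "0 \<in> H"
    using subgroup.one_closed[OF H(1)] by (simp add: G_def)
  ultimately obtain r where r: "r \<in> H" "r \<noteq> 0"
    by blast
  interpret GH: group "G\<lparr>carrier := H\<rparr>"
    by (rule subgroup.subgroup_is_group[OF H(1) G])
  have pow: "r [^]\<^bsub>G\<lparr>carrier := H\<rparr>\<^esub> n = of_nat n * r" for n :: nat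
    by (induction n) (simp_all add: G_def algebra_simps)
  have "of_nat p * r = 0"
    using GH.pow_order_eq_1[of r] r(1) H(2) by (simp add: pow order_def) (simp add: G_def)
  with r show ?thesis by blast
qed

text \<open>The field is a vector space over Z/p, so it projects onto Z/p, and Z/p embeds into the
  ring by sending 1 to an element \<open>r\<close> of additive order \<open>p\<close>.\<close>

lemma exists_nonzero_additive:
  assumes "CHAR('f) dvd CARD('r)"
  shows "\<exists>h :: 'f :: {field, finite} \<Rightarrow> 'r :: {ring_1, finite}. Modules.additive h \<and> h \<noteq> (\<lambda>_. 0)"
proof -
  define p where "p = CHAR('f)"
  have p: "prime p"
    unfolding p_def by (rule prime_CHAR_semidom) (rule finite_imp_CHAR_pos, rule finite)
  obtain r :: 'r where r: "r \<noteq> 0" "of_nat p * r = 0"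
    using exists_torsion_element[OF p] assms p_def by blast
  have kill: "of_int k * r = 0" if "int p dvd k" for k
  proof -
    obtain j where "k = j * int p"
      using \<open>int p dvd k\<close> by (metis dvd_def mult.commute)
    then show ?thesis
      using r(2) by (simp add: mult.assoc)
  qed
  have inverse_mod: "\<exists>a. of_int a * of_int j = (1 :: 'f)" if "\<not> int p dvd j" for j
  proof -
    have "coprime (int p) j"
      using p that by (simp add: prime_imp_coprime)
    then obtain a b where "a * j + b * int p = 1"
      by (metis bezout_int coprime_iff_gcd_eq_1 add.commute)
    then have "of_int (a * j + b * int p) = (1 :: 'f)"
      by (metis of_int_1)
    then show ?thesis
      by (auto simp: p_def)
  qed
  \<comment> \<open>A maximal subgroup \<open>M\<close> of \<open>'f\<close> avoiding 1 has quotient generated by 1, so \<open>y \<mapsto> k r\<close> for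
    \<open>y \<in> k + M\<close> is the required map.\<close>
  define \<S> where "\<S> = {S :: 'f set. 0 \<in> S \<and> 1 \<notin> S \<and> (\<forall>x\<in>S. \<forall>y\<in>S. x - y \<in> S)}"
  have "{0} \<in> \<S>"
    by (simp add: \<S>_def)
  then obtain M where M: "M \<in> \<S>" and max: "\<And>S. S \<in> \<S> \<Longrightarrow> M \<subseteq> S \<Longrightarrow> S = M"
    using finite_has_maximal[of \<S>] by (metis empty_iff finite)
  have Mdiff: "x - y \<in> M" if "x \<in> M" "y \<in> M" for x y
    using M that by (auto simp: \<S>_def)
  have M0: "0 \<in> M" and M1: "1 \<notin> M"
    using M by (auto simp: \<S>_def)
  have Mneg: "- x \<in> M" if "x \<in> M" for x
    using Mdiff[OF M0 that] by simp
  have Madd: "x + y \<in> M" if "x \<in> M" "y \<in> M" for x y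
    using Mdiff[OF that(1) Mneg[OF that(2)]] by simp
  have Mnat: "of_nat n * x \<in> M" if "x \<in> M" for x n
    using that by (induction n) (auto simp: M0 algebra_simps intro: Madd)
  have Mint: "of_int k * x \<in> M" if "x \<in> M" for x k
    using Mnat[OF that, of "nat \<bar>k\<bar>"] Mneg by (cases "k \<ge> 0") (auto simp: abs_if, force)
  \<comment> \<open>An integer prime to \<open>p\<close> in \<open>M\<close> could be multiplied by
    its inverse modulo \<open>p\<close>, which would put 1 into \<open>M\<close>.\<close>
  have dvd: "int p dvd k" if "of_int k \<in> M" for k
    using inverse_mod[of k] Mint[OF that] M1 by metis
  have ex: "\<exists>k. y - of_int k \<in> M" for y
  proof (cases "y \<in> M")
    case True
    then show ?thesis by (auto intro: exI[of _ 0])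
  next
    case False
    \<comment> \<open>The subgroup generated by \<open>M\<close> and \<open>y\<close>. It is
      strictly larger than \<open>M\<close>, so by maximality it contains 1; solving that relation
      for \<open>y\<close> shows that \<open>y\<close> is an integer modulo
      \<open>M\<close>.\<close>
    define S where "S = {m + of_int j * y | m j. m \<in> M}"
    have diff: "x - x' \<in> S" if S: "x \<in> S" "x' \<in> S" for x x'
    proof -
      obtain m j m' j' where *: "x = m + of_int j * y" "m \<in> M" "x' = m' + of_int j' * y" "m' \<in> M"
        using S unfolding S_def by blast
      then have "x - x' = (m - m') + of_int (j - j') * y"
        by (simp add: algebra_simps)
      with * Mdiff show ?thesis
        unfolding S_def by blast
    qed
    have "M \<subseteq> S"
    proof
      fix m assume "m \<in> M"
      then show "m \<in> S"
        unfolding S_def by (intro CollectI exI[of _ m] exI[of _ 0]) simp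
    qed
    moreover have "y \<in> S"
      using M0 unfolding S_def by (intro CollectI exI[of _ 0] exI[of _ 1]) simp
    ultimately have "S \<notin> \<S>"
      using max False by blast
    then have "1 \<in> S"
      using diff \<open>M \<subseteq> S\<close> M0 by (auto simp: \<S>_def)
    then obtain m j where m: "1 = m + of_int j * y" "m \<in> M"
      unfolding S_def by blast
    have "\<not> int p dvd j"
    proof
      assume "int p dvd j"
      then have "of_int j = (0 :: 'f)"
        by (auto simp: p_def)
      with m M1 show False by simp
    qed
    then obtain a where a: "of_int a * of_int j = (1 :: 'f)"
      using inverse_mod by blast
    have "of_int a = of_int a * m + y"
      using arg_cong[OF m(1), of "\<lambda>z. of_int a * z"] a
      by (simp add: distrib_left mult.assoc[symmetric])
    then have "y - of_int a = - (of_int a * m)"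
      by (simp add: algebra_simps)
    then show ?thesis
      using Mneg[OF Mint[OF m(2)]] by metis
  qed
  then obtain \<kappa> where \<kappa>: "\<And>y. y - of_int (\<kappa> y) \<in> M"
    by metis
  \<comment> \<open>\<open>\<kappa>\<close> merely chooses representatives, so it is additive only
    modulo \<open>p\<close>; multiplication by \<open>r\<close> absorbs the discrepancy.\<close>
  have add: "of_int (\<kappa> (x + y)) * r = of_int (\<kappa> x) * r + of_int (\<kappa> y) * r" for x y
  proof -
    have "of_int (\<kappa> (x + y) - \<kappa> x - \<kappa> y) =
        (x - of_int (\<kappa> x)) + (y - of_int (\<kappa> y)) - (x + y - of_int (\<kappa> (x + y)))"
      by simp
    also have "\<dots> \<in> M"
      by (intro Mdiff Madd \<kappa>)
    finally have "of_int (\<kappa> (x + y) - \<kappa> x - \<kappa> y) * r = 0"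
      by (intro kill dvd)
    then show ?thesis
      by (simp add: algebra_simps)
  qed
  have "of_int (1 - \<kappa> 1) \<in> M"
    using \<kappa>[of 1] by simp
  then have "of_int (1 - \<kappa> 1) * r = 0"
    by (intro kill dvd)
  then have "of_int (\<kappa> 1) * r = r"
    by (simp add: algebra_simps)
  then show ?thesis
    using add r(1) by (intro exI[of _ "\<lambda>y. of_int (\<kappa> y) * r"]) (auto simp: Modules.additive_def fun_eq_iff intro: exI[of _ 1])
qed

text \<open>Span and linear independence for scalars acting by \<open>(c h) x = h (c x)\<close>; in
  \<open>independent\<close>, \<open>f\<close> is the point at which the combination is
  evaluated.\<close>

locale additive_basis =
  fixes d :: nat and h :: "nat \<Rightarrow> 'f :: {field, finite} \<Rightarrow> 'r :: {ring_1, finite}"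
  assumes additive: "Modules.additive (h \<beta>)"
    and spanning: "Modules.additive g \<Longrightarrow> \<exists>c. \<forall>x. g x = (\<Sum>\<alpha><d. h \<alpha> (c \<alpha> * x))"
    and independent: "(\<And>f. (\<Sum>\<beta><d. h \<beta> (f * c \<beta>)) = 0) \<Longrightarrow> \<beta> < d \<Longrightarrow> c \<beta> = 0"

text \<open>The space of maps is finite, so a maximal independent set exists, and over a field such
  a set spans.\<close>

lemma exists_additive_basis:
  "\<exists>d h. additive_basis d (h :: nat \<Rightarrow> 'f :: {field, finite} \<Rightarrow> 'r :: {ring_1, finite})"
proof -
  define indep where
    "indep S \<longleftrightarrow> (\<forall>c. (\<forall>f. (\<Sum>h\<in>S. h (f * c h)) = 0) \<longrightarrow> (\<forall>h\<in>S. c h = 0))" for S :: "('f \<Rightarrow> 'r) set"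
  define \<S> where "\<S> = {S. S \<subseteq> Collect Modules.additive \<and> indep S}"
  have "{} \<in> \<S>"
    by (simp add: \<S>_def indep_def)
  then obtain S where S: "S \<in> \<S>" and max: "\<And>S'. S' \<in> \<S> \<Longrightarrow> S \<subseteq> S' \<Longrightarrow> S' = S"
    using finite_has_maximal[of \<S>] by (metis empty_iff finite)
  have add: "Modules.additive h" if "h \<in> S" for h
    using S that by (auto simp: \<S>_def)
  have span: "\<exists>c. \<forall>x. g x = (\<Sum>h\<in>S. h (c h * x))" if g: "Modules.additive g" for g
  proof (cases "g \<in> S")
    case True
    have "g x = (\<Sum>h\<in>S. h ((if h = g then 1 else 0) * x))" for x
    proof -
      have "(\<Sum>h\<in>S. h ((if h = g then 1 else 0) * x)) = (\<Sum>h\<in>S. if h = g then g x else 0)"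
        by (intro sum.cong) (auto simp: additive.zero[OF add])
      then show ?thesis
        using True by simp
    qed
    then show ?thesis
      by (intro exI[of _ "\<lambda>h. if h = g then 1 else 0"] allI)
  next
    case False
    then have "insert g S \<notin> \<S>"
      using max by blast
    then have "\<not> indep (insert g S)"
      using g add by (auto simp: \<S>_def)
    then obtain c where c: "\<And>f. (\<Sum>h\<in>insert g S. h (f * c h)) = 0" and nz: "\<exists>h\<in>insert g S. c h \<noteq> 0"
      by (auto simp: indep_def)
    have sum: "g (f * c g) = - (\<Sum>h\<in>S. h (f * c h))" for f
      using c[of f] False by (simp add: eq_neg_iff_add_eq_0)
    have "c g \<noteq> 0"
    proof
      assume "c g = 0"
      then have "\<forall>f. (\<Sum>h\<in>S. h (f * c h)) = 0"
        using sum additive.zero[OF g] by simp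
      then show False
        using S nz \<open>c g = 0\<close> by (auto simp: \<S>_def indep_def)
    qed
    \<comment> \<open>Evaluating the dependence at \<open>f = x / c g\<close> solves it for
      \<open>g x\<close>.\<close>
    then have "g x = (\<Sum>h\<in>S. h (- (c h / c g) * x))" for x
      using sum[of "x / c g"]
      by (simp add: sum_negf[symmetric] additive.minus[OF add, symmetric] mult.commute)
    then show ?thesis
      by (intro exI[of _ "\<lambda>h. - (c h / c g)"] allI)
  qed
  obtain e where e: "bij_betw e {..<card S} S"
    using ex_bij_betw_nat_finite[of S] by (auto simp: atLeast0LessThan)
  \<comment> \<open>The zero map fills the indices from \<open>card S\<close> on, because the locale
    asks for additivity at every index.\<close>
  define h where "h \<beta> = (if \<beta> < card S then e \<beta> else (\<lambda>_. 0))" for \<beta>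
  have inv: "the_inv_into {..<card S} e (e \<beta>) = \<beta>" if "\<beta> < card S" for \<beta>
    using e that by (simp add: bij_betw_def the_inv_into_f_f)
  have reindex: "(\<Sum>h\<in>S. F h) = (\<Sum>\<beta><card S. F (h \<beta>))" for F :: "('f \<Rightarrow> 'r) \<Rightarrow> 'r"
    by (subst sum.reindex_bij_betw[OF e, symmetric]) (simp add: h_def)
  have "additive_basis (card S) h"
  proof (rule additive_basis.intro)
    show "Modules.additive (h \<beta>)" for \<beta>
      using add bij_betwE[OF e] by (auto simp: h_def Modules.additive_def)
  next
    fix g :: "'f \<Rightarrow> 'r" assume "Modules.additive g"
    then obtain c where "\<forall>x. g x = (\<Sum>h\<in>S. h (c h * x))"
      using span by blast
    then show "\<exists>c. \<forall>x. g x = (\<Sum>\<alpha><card S. h \<alpha> (c \<alpha> * x))"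
      unfolding reindex by (intro exI[of _ "\<lambda>\<alpha>. c (h \<alpha>)"])
  next
    fix c \<beta> assume c: "\<And>f. (\<Sum>\<beta><card S. h \<beta> (f * c \<beta>)) = 0" and \<beta>: "\<beta> < card S"
    have zero: "\<forall>f. (\<Sum>h\<in>S. h (f * c (the_inv_into {..<card S} e h))) = 0"
      unfolding reindex using c by (simp add: h_def inv cong: sum.cong_simp)
    have "indep S"
      using S by (simp add: \<S>_def)
    then have "\<forall>h\<in>S. c (the_inv_into {..<card S} e h) = 0"
      unfolding indep_def by (rule allE) (erule mp, rule zero)
    moreover have "e \<beta> \<in> S"
      using bij_betwE[OF e] \<beta> by simp
    ultimately show "c \<beta> = 0"
      using inv[OF \<beta>] by metis
  qed
  then show ?thesis by blast
qed

section \<open>Transfer of codes\<close>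

text \<open>By distributivity each \<open>a * x * b\<close> is additive in \<open>x\<close>; in this
  form two-sided linearity over the given ring enters the transfer.\<close>

lemma two_sided_linear_additive:
  assumes "two_sided_linear N C v g"
  shows "\<exists>\<phi>. (\<forall>q l. Modules.additive (\<phi> q l)) \<and>
    (\<forall>u\<in>input_space N C v. g u = (\<Sum>q\<in>inputs N v. \<Sum>l<input_dim C q. \<phi> q l (u q l)))"
proof -
  obtain s a b where g: "\<forall>u\<in>input_space N C v.
      g u = (\<Sum>q\<in>inputs N v. \<Sum>l<input_dim C q. \<Sum>j<s q l. a q l j * u q l * b q l (j :: nat))"
    using assms by (auto simp: two_sided_linear_def)
  show ?thesis
    by (intro exI[of _ "\<lambda>q l x. \<Sum>j<s q l. a q l j * x * b q l j"])
       (use g in \<open>auto simp: Modules.additive_def distrib_left distrib_right sum.distrib\<close>)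
qed

definition matrix_map :: "'q set \<Rightarrow> ('q \<Rightarrow> nat) \<Rightarrow> nat \<Rightarrow> (nat \<Rightarrow> 'q \<Rightarrow> nat \<Rightarrow> 'f) \<Rightarrow>
    ('q \<Rightarrow> nat \<Rightarrow> 'f) \<Rightarrow> nat \<Rightarrow> 'f :: comm_ring_1" where
  "matrix_map Q k K A u = (\<lambda>t\<in>{..<K}. \<Sum>q\<in>Q. \<Sum>s<k q. A t q s * u q s)"

lemma matrix_map_vectors: "matrix_map Q k K A u \<in> vectors K"
  by (simp add: matrix_map_def vectors_def)

lemma two_sided_linear_matrix_map:
  assumes "l < K"
  shows "two_sided_linear N C v (\<lambda>u. matrix_map (inputs N v) (input_dim C) K A u l)"
  unfolding two_sided_linear_def
  by (rule exI[of _ "\<lambda>_ _. 1"], rule exI[of _ "\<lambda>q s _. A l q s"], rule exI[of _ "\<lambda>_ _ _. 1"])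
     (use assms in \<open>simp add: matrix_map_def\<close>)

section \<open>Collapse maps and intertwining matrices\<close>

context additive_basis
begin

text \<open>
  Coordinates \<open>l * d, \<dots>, l * d + d - 1\<close> of a vector over \<open>'f\<close> encode coordinate \<open>l\<close> over \<open>'r\<close>.
\<close>
definition collapse :: "'f \<Rightarrow> nat \<Rightarrow> (nat \<Rightarrow> 'f) \<Rightarrow> nat \<Rightarrow> 'r" where
  "collapse f k w = (\<lambda>l\<in>{..<k}. \<Sum>\<beta><d. h \<beta> (f * w (l * d + \<beta>)))"

lemma collapse_vectors: "collapse f k w \<in> vectors k"
  by (simp add: collapse_def vectors_def)

text \<open>Independence applies, block by block, to the difference of the two vectors; beyond
  \<open>k * d\<close> both are \<open>undefined\<close>.\<close>

lemma collapse_injective: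
  assumes "\<And>f. collapse f k w = collapse f k w'"
    and "w \<in> vectors (k * d)" "w' \<in> vectors (k * d)"
  shows "w = w'"
proof
  fix t
  show "w t = w' t"
  proof (cases "t < k * d")
    case True
    define l where "l = t div d"
    have d: "d > 0"
      using True by (cases d) auto
    have l: "l < k"
      using True unfolding l_def by (simp add: less_mult_imp_div_less)
    have "(\<Sum>\<beta><d. h \<beta> (f * (w (l * d + \<beta>) - w' (l * d + \<beta>)))) = 0" for f
      using fun_cong[OF assms(1)[of f], of l] l
      by (simp add: collapse_def right_diff_distrib additive.diff[OF additive] sum_subtractf)
    from independent[of "\<lambda>\<beta>. w (l * d + \<beta>) - w' (l * d + \<beta>)", OF this, of "t mod d"] d
    show ?thesis
      by (simp add: l_def)
  next
    case False
    then show ?thesis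
      using assms(2,3) by (auto simp: vectors_def PiE_def extensional_def)
  qed
qed

text \<open>Column \<open>\<beta>\<close> of \<open>M\<close> holds the coordinates of the additive
  map \<open>\<phi>\<close> composed with \<open>h \<beta>\<close>. Since \<open>'f\<close> is
  commutative, \<open>f\<close> moves past the entries, so one matrix serves all
  \<open>f\<close>.\<close>

lemma intertwining_matrix:
  assumes "Modules.additive \<phi>"
  shows "\<exists>M. \<forall>f w. \<phi> (\<Sum>\<beta><d. h \<beta> (f * w \<beta>)) = (\<Sum>\<alpha><d. h \<alpha> (f * (\<Sum>\<beta><d. M \<alpha> \<beta> * w \<beta>)))"
proof -
  have "Modules.additive (\<lambda>x. \<phi> (h \<beta> x))" for \<beta>
    using assms additive by (simp add: Modules.additive_def)
  then have "\<forall>\<beta>. \<exists>c. \<forall>x. \<phi> (h \<beta> x) = (\<Sum>\<alpha><d. h \<alpha> (c \<alpha> * x))"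
    using spanning by blast
  then obtain M where M: "\<And>\<beta> x. \<phi> (h \<beta> x) = (\<Sum>\<alpha><d. h \<alpha> (M \<beta> \<alpha> * x))"
    by metis
  have "\<phi> (\<Sum>\<beta><d. h \<beta> (f * w \<beta>)) = (\<Sum>\<alpha><d. h \<alpha> (f * (\<Sum>\<beta><d. M \<beta> \<alpha> * w \<beta>)))" for f w
  proof -
    have "\<phi> (\<Sum>\<beta><d. h \<beta> (f * w \<beta>)) = (\<Sum>\<beta><d. \<Sum>\<alpha><d. h \<alpha> (M \<beta> \<alpha> * (f * w \<beta>)))"
      by (simp add: additive.sum[OF assms] M)
    also have "\<dots> = (\<Sum>\<alpha><d. \<Sum>\<beta><d. h \<alpha> (M \<beta> \<alpha> * (f * w \<beta>)))"
      by (rule sum.swap)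
    also have "\<dots> = (\<Sum>\<alpha><d. h \<alpha> (f * (\<Sum>\<beta><d. M \<beta> \<alpha> * w \<beta>)))"
      by (simp add: additive.sum[OF additive] sum_distrib_left mult.left_commute)
    finally show ?thesis .
  qed
  then show ?thesis
    by (intro exI[of _ "\<lambda>\<alpha> \<beta>. M \<beta> \<alpha>"] allI)
qed

lemma sum_blocks:
  fixes F :: "nat \<Rightarrow> 'b :: comm_monoid_add"
  shows "(\<Sum>t<k * d. F t) = (\<Sum>l<k. \<Sum>\<beta><d. F (l * d + \<beta>))"
proof -
  have "(\<Sum>\<beta><d. F (l * d + \<beta>)) = sum F {l * d..<l * d + d}" for l
    using sum.shift_bounds_nat_ivl[of F 0 "l * d" d]
    by (simp add: atLeast0LessThan add.commute)
  then show ?thesis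
    by (simp add: sum.nat_group)
qed

definition collapse_inputs ::
    "('v, 'e) network \<Rightarrow> ('v, 'e, 'r) code \<Rightarrow> 'v \<Rightarrow> 'f \<Rightarrow> ('e input \<Rightarrow> nat \<Rightarrow> 'f) \<Rightarrow> 'e input \<Rightarrow> nat \<Rightarrow> 'r" where
  "collapse_inputs N C v f u = (\<lambda>q\<in>inputs N v. collapse f (input_dim C q) (u q))"

lemma collapse_inputs_in_input_space: "collapse_inputs N C v f u \<in> input_space N C v"
  by (simp add: collapse_inputs_def input_space_def collapse_vectors)

lemma intertwining_functional:
  assumes "two_sided_linear N C v g"
  shows "\<exists>A. \<forall>f u. g (collapse_inputs N C v f u) =
    (\<Sum>\<alpha><d. h \<alpha> (f * (\<Sum>q\<in>inputs N v. \<Sum>s<input_dim C q * d. A \<alpha> q s * u q s)))"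
proof -
  obtain \<phi> where add: "\<And>q l. Modules.additive (\<phi> q l)"
    and g: "\<And>u. u \<in> input_space N C v \<Longrightarrow> g u = (\<Sum>q\<in>inputs N v. \<Sum>l<input_dim C q. \<phi> q l (u q l))"
    using two_sided_linear_additive[OF assms] by blast
  have "\<forall>q l. \<exists>M. \<forall>f w. \<phi> q l (\<Sum>\<beta><d. h \<beta> (f * w \<beta>)) = (\<Sum>\<alpha><d. h \<alpha> (f * (\<Sum>\<beta><d. M \<alpha> \<beta> * w \<beta>)))"
    using intertwining_matrix[OF add] by blast
  then obtain M where "\<forall>q l f w. \<phi> q l (\<Sum>\<beta><d. h \<beta> (f * w \<beta>)) =
      (\<Sum>\<alpha><d. h \<alpha> (f * (\<Sum>\<beta><d. M q l \<alpha> \<beta> * w \<beta>)))"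
    unfolding choice_iff by (elim exE)
  then have M: "\<phi> q l (\<Sum>\<beta><d. h \<beta> (f * w \<beta>)) =
      (\<Sum>\<alpha><d. h \<alpha> (f * (\<Sum>\<beta><d. M q l \<alpha> \<beta> * w \<beta>)))" for q l f w
    by blast
  \<comment> \<open>The blocks \<open>M q l\<close> are laid side by side: column \<open>s\<close>
    is column \<open>s mod d\<close> of block \<open>s div d\<close>.\<close>
  define A where "A \<alpha> q s = M q (s div d) \<alpha> (s mod d)" for \<alpha> q s
  have A: "A \<alpha> q (l * d + \<beta>) = M q l \<alpha> \<beta>" if "\<beta> < d" for \<alpha> q l \<beta>
    using that by (simp add: A_def)
  have "g (collapse_inputs N C v f u) =
    (\<Sum>\<alpha><d. h \<alpha> (f * (\<Sum>q\<in>inputs N v. \<Sum>s<input_dim C q * d. A \<alpha> q s * u q s)))" for f u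
  proof -
    have "g (collapse_inputs N C v f u) =
      (\<Sum>q\<in>inputs N v. \<Sum>l<input_dim C q. \<phi> q l (\<Sum>\<beta><d. h \<beta> (f * u q (l * d + \<beta>))))"
      by (simp add: g[OF collapse_inputs_in_input_space])
         (simp add: collapse_inputs_def collapse_def)
    also have "\<dots> = (\<Sum>q\<in>inputs N v. \<Sum>l<input_dim C q.
        \<Sum>\<alpha><d. h \<alpha> (f * (\<Sum>\<beta><d. A \<alpha> q (l * d + \<beta>) * u q (l * d + \<beta>))))"
      by (simp add: M[of _ _ f "\<lambda>\<beta>. u _ (_ * d + \<beta>)"] A cong: sum.cong_simp)
    also have "\<dots> = (\<Sum>q\<in>inputs N v. \<Sum>\<alpha><d. \<Sum>l<input_dim C q.
        h \<alpha> (f * (\<Sum>\<beta><d. A \<alpha> q (l * d + \<beta>) * u q (l * d + \<beta>))))"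
      by (intro sum.cong refl sum.swap)
    also have "\<dots> = (\<Sum>\<alpha><d. \<Sum>q\<in>inputs N v. \<Sum>l<input_dim C q.
        h \<alpha> (f * (\<Sum>\<beta><d. A \<alpha> q (l * d + \<beta>) * u q (l * d + \<beta>))))"
      by (rule sum.swap)
    also have "\<dots> = (\<Sum>\<alpha><d. h \<alpha> (f * (\<Sum>q\<in>inputs N v. \<Sum>s<input_dim C q * d. A \<alpha> q s * u q s)))"
      by (simp add: sum_blocks additive.sum[OF additive, symmetric] sum_distrib_left[symmetric])
    finally show ?thesis .
  qed
  then show ?thesis by blast
qed

text \<open>Stacks the \<open>d\<close> rows obtained for each output coordinate. \<open>A\<close>
  is chosen before \<open>f\<close>, so it can define a code independent of
  \<open>f\<close>.\<close>

lemma intertwining_matrix_map: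
  assumes linear: "\<And>l. l < K \<Longrightarrow> two_sided_linear N C v (\<lambda>u. G u l)"
    and G: "G \<in> input_space N C v \<rightarrow> vectors K"
  shows "\<exists>A. \<forall>f u. G (collapse_inputs N C v f u) =
    collapse f K (matrix_map (inputs N v) (\<lambda>q. input_dim C q * d) (K * d) A u)"
proof -
  have "\<forall>l. \<exists>A. l < K \<longrightarrow> (\<forall>f u. G (collapse_inputs N C v f u) l =
    (\<Sum>\<alpha><d. h \<alpha> (f * (\<Sum>q\<in>inputs N v. \<Sum>s<input_dim C q * d. A \<alpha> q s * u q s))))"
    using intertwining_functional[OF linear] by blast
  then obtain A where "\<forall>l. l < K \<longrightarrow> (\<forall>f u. G (collapse_inputs N C v f u) l =
    (\<Sum>\<alpha><d. h \<alpha> (f * (\<Sum>q\<in>inputs N v. \<Sum>s<input_dim C q * d. A l \<alpha> q s * u q s))))"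
    unfolding choice_iff by (elim exE)
  then have A: "G (collapse_inputs N C v f u) l =
    (\<Sum>\<alpha><d. h \<alpha> (f * (\<Sum>q\<in>inputs N v. \<Sum>s<input_dim C q * d. A l \<alpha> q s * u q s)))" if "l < K" for l f u
    using that by blast
  define B where "B t = A (t div d) (t mod d)" for t
  have "G (collapse_inputs N C v f u) l =
    collapse f K (matrix_map (inputs N v) (\<lambda>q. input_dim C q * d) (K * d) B u) l" for f u l
  proof (cases "l < K")
    case True
    have "l * d + \<alpha> < K * d" if "\<alpha> < d" for \<alpha>
    proof -
      have "l * d + \<alpha> < Suc l * d"
        using that by simp
      also have "\<dots> \<le> K * d"
        using True by (intro mult_le_mono1) simp
      finally show ?thesis .
    qed
    then show ?thesis
      using True by (simp add: A collapse_def matrix_map_def B_def cong: sum.cong_simp)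
  next
    case False
    have "G (collapse_inputs N C v f u) \<in> vectors K"
      using G by (rule funcset_mem) (rule collapse_inputs_in_input_space)
    with False show ?thesis
      by (simp add: vectors_def PiE_def extensional_def collapse_def)
  qed
  then show ?thesis
    by (intro exI[of _ B] allI ext)
qed

text \<open>All dimensions are multiplied by \<open>d\<close>, which cancels in the rates;
  \<open>d > 0\<close> also keeps the edge dimension positive.\<close>

lemma achievable_transfer:
  assumes "network N" and "d > 0" and "linearly_achievable N TYPE('r) \<rho>"
  shows "linearly_achievable N TYPE('f) \<rho>"
proof -
  interpret network N by fact
  obtain C :: "('a, 'b, 'r) code" where lin: "is_linear_code N C" and sol: "is_solution N C"
    and rate: "\<forall>i<num_messages N. \<rho> i = real (message_dim C i) / real (edge_dim C)"
    using assms(3) by (auto simp: linearly_achievable_def)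
  have code: "is_code N C"
    using lin by (simp add: is_linear_code_def)
  define k n where "k i = message_dim C i * d" and "n = edge_dim C * d" for i
  define dim where "dim q = input_dim C q * d" for q :: "'b input"
  let ?tail = "tail (graph N)"
  have "\<exists>A. \<forall>f u. edge_fun C e (collapse_inputs N C (?tail e) f u) =
      collapse f (edge_dim C) (matrix_map (inputs N (?tail e)) dim n A u)"
    if "e \<in> arcs (graph N)" for e
    unfolding dim_def n_def using lin code that
    by (intro intertwining_matrix_map) (auto simp: is_linear_code_def is_code_def)
  then obtain A where A: "\<And>e f u. e \<in> arcs (graph N) \<Longrightarrow>
      edge_fun C e (collapse_inputs N C (?tail e) f u) =
      collapse f (edge_dim C) (matrix_map (inputs N (?tail e)) dim n (A e) u)"
    by metis
  have "\<exists>B. \<forall>f u. decoding_fun C v i (collapse_inputs N C v f u) =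
      collapse f (message_dim C i) (matrix_map (inputs N v) dim (k i) B u)"
    if "v \<in> receivers N" "i \<in> demands N v" for v i
    unfolding dim_def k_def using lin code that
    by (intro intertwining_matrix_map) (auto simp: is_linear_code_def is_code_def)
  then obtain B where B: "\<And>v i f u. v \<in> receivers N \<Longrightarrow> i \<in> demands N v \<Longrightarrow>
      decoding_fun C v i (collapse_inputs N C v f u) =
      collapse f (message_dim C i) (matrix_map (inputs N v) dim (k i) (B v i) u)"
    by metis
  define C' :: "('a, 'b, 'f) code" where "C' = \<lparr>message_dim = k, edge_dim = n,
    edge_fun = (\<lambda>e. matrix_map (inputs N (?tail e)) dim n (A e)),
    decoding_fun = (\<lambda>v i. matrix_map (inputs N v) dim (k i) (B v i))\<rparr>"
  have dim: "input_dim C' = dim"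
  proof
    show "input_dim C' q = dim q" for q
      by (cases q) (simp_all add: C'_def dim_def k_def n_def)
  qed
  have code': "is_code N C'"
    using code assms(2) by (auto simp: is_code_def C'_def matrix_map_vectors n_def)
  have "is_linear_code N C'"
    using code' two_sided_linear_matrix_map[of _ _ N C', unfolded dim]
    by (auto simp: is_linear_code_def) (simp_all add: C'_def)
  moreover have "is_solution N C'"
    unfolding is_solution_def
  proof (intro conjI ballI allI impI code')
    fix x y v i
    assume x: "x \<in> (\<Pi>\<^sub>E i\<in>{..<num_messages N}. vectors (message_dim C' i))"
      and y: "carried N C' x y" and v: "v \<in> receivers N" and i: "i \<in> demands N v"
    \<comment> \<open>The image under \<open>collapse f\<close> of a run of \<open>C'\<close> is a
      run of \<open>C\<close>, so \<open>C\<close> decodes the collapsed messages for every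
      \<open>f\<close>; joint injectivity then recovers \<open>x i\<close>.\<close>
    define X where "X f = (\<lambda>i\<in>{..<num_messages N}. collapse f (message_dim C i) (x i))" for f
    define Y where "Y f e = collapse f (edge_dim C) (y e)" for f e
    have inputs: "input_values N (X f) (Y f) w = collapse_inputs N C w f (input_values N x y w)" for f w
    proof
      show "input_values N (X f) (Y f) w q = collapse_inputs N C w f (input_values N x y w) q" for q
        by (cases q) (auto simp: input_values_def collapse_inputs_def X_def Y_def inputs_def)
    qed
    have "carried N C (X f) (Y f)" for f
      using y by (simp add: carried_def inputs A) (simp add: C'_def Y_def)
    moreover have "X f \<in> (\<Pi>\<^sub>E i\<in>{..<num_messages N}. vectors (message_dim C i))" for f
      by (simp add: X_def collapse_vectors)
    ultimately have "decoding_fun C v i (input_values N (X f) (Y f) v) = X f i" for f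
      using sol v i unfolding is_solution_def by blast
    moreover have "i < num_messages N"
      using demands_messages v i by blast
    ultimately have "collapse f (message_dim C i) (decoding_fun C' v i (input_values N x y v)) =
        collapse f (message_dim C i) (x i)" for f
      using v i by (simp add: inputs B C'_def) (simp add: X_def)
    moreover have "decoding_fun C' v i (input_values N x y v) \<in> vectors (message_dim C i * d)"
      using matrix_map_vectors by (simp add: C'_def k_def)
    moreover have "x i \<in> vectors (message_dim C i * d)"
      using x \<open>i < num_messages N\<close> by (auto simp: C'_def k_def)
    ultimately show "decoding_fun C' v i (input_values N x y v) = x i"
      by (rule collapse_injective)
  qed
  moreover have "\<forall>i<num_messages N. \<rho> i = real (message_dim C' i) / real (edge_dim C')"
    using rate assms(2) by (simp add: C'_def k_def n_def)
  ultimately show ?thesis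
    unfolding linearly_achievable_def by blast
qed

end

theorem corollary4p3:
  fixes N :: "('v, 'e) network"
  assumes "network N"
    and "CHAR('f) dvd CARD('r)"
  shows "linear_capacity N TYPE('r :: {ring_1, finite}) \<le> linear_capacity N TYPE('f :: {field, finite})"
proof -
  obtain d and h :: "nat \<Rightarrow> 'f \<Rightarrow> 'r" where "additive_basis d h"
    using exists_additive_basis by blast
  then interpret additive_basis d h .
  obtain g :: "'f \<Rightarrow> 'r" where "Modules.additive g" "g \<noteq> (\<lambda>_. 0)"
    using exists_nonzero_additive[OF assms(2)] by blast
  \<comment> \<open>For \<open>d = 0\<close> the spanning sum is empty, which would force
    \<open>g\<close> to vanish.\<close>
  then have "d > 0"
    using spanning[of g] by (cases d) auto
  then show ?thesis
    unfolding linear_capacity_def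
    by (intro SUP_subset_mono) (auto intro: achievable_transfer[OF assms(1)])
qed

end
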